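(* Let $n\ge 2$ be an integer, $\beta>0$, and $0<u_0<k\le 2u_0$. Let $H(u,y)=\frac{y^2}{2}+\beta\left(-\frac{u^4}{4}+\frac{k+u_0}{3}u^3-\frac{ku_0}{2}u^2\right)$ and, for $h\in(h_1,h_2):=\left(\frac{\beta u_0^3}{12}(u_0-2k),\ \frac{\beta k^3}{12}(k-2u_0)\right)$, let $\Gamma_h$ be the closed component of $\{H(u,y)=h\}$ surrounding $(u_0,0)$. Then the function $$G_n(h):=\frac{\oint_{\Gamma_h}u^n y\,du}{\oint_{\Gamma_h}y\,du}$$ is monotone on $(h_1,h_2)$.
   Context: For these parameters $(u_0,0)$ is a center of the Hamiltonian system $u'=y$, $y'=-\beta u(u-u_0)(k-u)$, and the curves $\Gamma_h$, $h\in(h_1,h_2)$, form the maximal periodic annulus around it ($h_1=H(u_0,0)$, $h_2=H(k,0)$, which equals $0$ when $k=2u_0$). The denominator $\oint_{\Gamma_h}y\,du$ is nonzero (its absolute value is the enclosed area). *)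

theory Defs
  imports "HOL-Analysis.Analysis"
begin

definition hpot :: "real \<Rightarrow> real \<Rightarrow> real \<Rightarrow> real \<Rightarrow> real" where
  "hpot \<beta> k u0 u = \<beta> * (- (u ^ 4) / 4 + (k + u0) / 3 * u ^ 3 - k * u0 / 2 * u ^ 2)"

definition Ham :: "real \<Rightarrow> real \<Rightarrow> real \<Rightarrow> real \<Rightarrow> real \<Rightarrow> real" where
  "Ham \<beta> k u0 u y = y ^ 2 / 2 + hpot \<beta> k u0 u"

text \<open>The u-interval spanned by the oval Gamma_h surrounding (u0,0):
  the connected component containing u0 of the set where hpot < h.
  Gamma_h = {(u,y). u in the closure of this interval, Ham u y = h}.\<close>
definition oval_base :: "real \<Rightarrow> real \<Rightarrow> real \<Rightarrow> real \<Rightarrow> real set" where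
  "oval_base \<beta> k u0 h = connected_component_set {u. hpot \<beta> k u0 u < h} u0"

text \<open>The line integral of u^n y du over the closed oval Gamma_h (clockwise
  orientation): the upper branch y = sqrt(2(h - hpot u)) traversed with u
  increasing and the lower branch y = - sqrt(2(h - hpot u)) traversed with
  u decreasing each contribute the integral of u^n sqrt(2(h - hpot u)) over
  the u-interval.\<close>
definition oval_integral :: "real \<Rightarrow> real \<Rightarrow> real \<Rightarrow> nat \<Rightarrow> real \<Rightarrow> real" where
  "oval_integral \<beta> k u0 n h =
     2 * integral (oval_base \<beta> k u0 h) (\<lambda>u. u ^ n * sqrt (2 * (h - hpot \<beta> k u0 u)))"

definition G :: "real \<Rightarrow> real \<Rightarrow> real \<Rightarrow> nat \<Rightarrow> real \<Rightarrow> real" where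
  "G \<beta> k u0 n h = oval_integral \<beta> k u0 n h / oval_integral \<beta> k u0 0 h"

end

theory Submission
  imports Defs
begin

text \<open>
  Let \<open>uL v < u0 < uR v\<close> be the turning points of the potential \<open>V\<close> at level \<open>v\<close>.
  Substituting \<open>v = V u\<close> on both halves of the oval turns the oval integrals into Abel
  transforms: \<open>oval_integral m h / 2\<close> is the integral over \<open>[h1, h]\<close> of
  \<open>A m v * sqrt (2 * (h - v))\<close>, where \<open>A m = uR ^ m / V' uR - uL ^ m / V' uL\<close>
  (\<open>abel_density\<close>). Moreover \<open>A n = \<psi> n * A 0\<close>, where \<open>\<psi> n v\<close> (\<open>turning_mean\<close>) is
  the mean of \<open>uR ^ n\<close> and \<open>uL ^ n\<close> with weights \<open>|V' uL|\<close> and \<open>|V' uR|\<close>; so \<open>G n h\<close>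
  averages \<open>\<psi> n\<close> against the kernel \<open>A 0 v * sqrt (2 * (h - v))\<close>.

  The mean \<open>\<psi> 1\<close> is nondecreasing in \<open>v\<close>: it equals \<open>u0\<close> when \<open>k = 2 * u0\<close>, and
  otherwise it is a rational function of \<open>s = uL + uR\<close> that increases on
  \<open>[2 * u0, u0 + k]\<close>, while \<open>s\<close> itself increases with \<open>v\<close>. As \<open>[uL, uR]\<close> expands with
  \<open>v\<close>, convexity of \<open>x ^ n\<close> carries this over to \<open>\<psi> n\<close>. Finally, for \<open>h < h'\<close> the
  kernels have the ratio \<open>sqrt ((h' - v) / (h - v))\<close>, increasing in \<open>v\<close>; so for every
  \<open>c < G n h\<close> the single sign change of \<open>(\<psi> n - c) * A 0\<close> forces \<open>c \<le> G n h'\<close>.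
\<close>

lemma convex_on_nonneg_power: "convex_on {0::real..} (\<lambda>x. x ^ n)"
  by (cases "even n") (auto intro: convex_on_subset[OF convex_power_even] convex_power_odd)

lemma convex_on_above_chord:
  fixes f :: "real \<Rightarrow> real"
  assumes f: "convex_on {a'..b'} f" and ab: "a' \<le> a" "a < b" "b \<le> b'"
    and x: "x \<in> {a'..a} \<union> {b..b'}"
  shows "f a + (f b - f a) / (b - a) * (x - a) \<le> f x"
proof -
  have "(b - a) * f a + (f b - f a) * (x - a) \<le> (b - a) * f x"
  proof (cases "x \<le> a")
    case True
    show ?thesis
    proof (cases "x = a")
      case False
      with True have "x < a" by simp
      have "convex_on {x..b} f"
        using x ab by (auto intro: convex_on_subset[OF f])
      then have "f a \<le> (f b - f x) / (b - x) * (a - x) + f x"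
        using convex_onD_Icc'[of x b f a] \<open>x < a\<close> ab by simp
      then have "(b - x) * f a \<le> (f b - f x) * (a - x) + (b - x) * f x"
        using \<open>x < a\<close> ab by (simp add: field_simps)
      then show ?thesis by (simp add: algebra_simps)
    qed simp
  next
    case False
    with x have "b \<le> x" by auto
    show ?thesis
    proof (cases "x = b")
      case False
      with \<open>b \<le> x\<close> have "b < x" by simp
      have "convex_on {a..x} f"
        using x ab by (auto intro: convex_on_subset[OF f])
      then have "f b \<le> (f x - f a) / (x - a) * (b - a) + f a"
        using convex_onD_Icc'[of a x f b] \<open>b < x\<close> ab by simp
      then have "(x - a) * f b \<le> (f x - f a) * (b - a) + (x - a) * f a"
        using \<open>b < x\<close> ab by (simp add: field_simps)
      then show ?thesis by (simp add: algebra_simps)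
    qed (simp add: algebra_simps)
  qed
  then show ?thesis
    using ab by (simp add: field_simps)
qed

lemma convex_two_point_mean_mono:
  fixes f :: "real \<Rightarrow> real"
  assumes f: "convex_on {a'..b'} f" and ab: "a' \<le> a" "a < b" "b \<le> b'" and "f a \<le> f b"
    and pos: "0 < p" "0 < q" "0 < p'" "0 < q'"
    and mean: "(b * p + a * q) / (p + q) \<le> (b' * p' + a' * q') / (p' + q')"
  shows "(f b * p + f a * q) / (p + q) \<le> (f b' * p' + f a' * q') / (p' + q')"
proof -
  define \<sigma> where "\<sigma> = (f b - f a) / (b - a)"
  define L where "L x = f a + \<sigma> * (x - a)" for x
  have "0 \<le> \<sigma>"
    using ab \<open>f a \<le> f b\<close> by (simp add: \<sigma>_def)
  then have "mono L"
    unfolding L_def by (intro monoI add_left_mono mult_left_mono) auto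
  have affine: "L ((y * r + x * s) / (r + s)) = (L y * r + L x * s) / (r + s)"
    if "0 < r + s" for x y r s
    unfolding L_def using that by (simp add: field_simps)
  have "(f b * p + f a * q) / (p + q) = L ((b * p + a * q) / (p + q))"
    using affine[of p q b a] pos ab by (simp add: L_def \<sigma>_def)
  also have "\<dots> \<le> L ((b' * p' + a' * q') / (p' + q'))"
    using \<open>mono L\<close> mean by (rule monoD)
  also have "\<dots> = (L b' * p' + L a' * q') / (p' + q')"
    using affine pos by simp
  also have "\<dots> \<le> (f b' * p' + f a' * q') / (p' + q')"
    using convex_on_above_chord[OF f ab, of a'] convex_on_above_chord[OF f ab, of b'] pos ab
    by (intro divide_right_mono add_mono mult_right_mono) (auto simp: L_def \<sigma>_def)
  finally show ?thesis .
qed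

lemma sqrt_kernel_factor:
  fixes v h h' :: real
  assumes "v < h"
  shows "sqrt (2 * (h' - v)) = sqrt ((h' - v) / (h - v)) * sqrt (2 * (h - v))"
proof -
  have "h - v \<noteq> 0"
    using assms by simp
  then have "(h' - v) / (h - v) * (2 * (h - v)) = 2 * (h' - v)"
    by (simp add: field_simps)
  then show ?thesis
    by (metis real_sqrt_mult)
qed

lemma kernel_ratio_mono:
  fixes v w h h' :: real
  assumes "v \<le> w" "w < h" "h \<le> h'"
  shows "(h' - v) / (h - v) \<le> (h' - w) / (h - w)"
proof -
  have "(h' - w) * (h - v) - (h' - v) * (h - w) = (h' - h) * (w - v)"
    by algebra
  also have "\<dots> \<ge> 0"
    using assms by simp
  finally show ?thesis
    using assms by (simp add: field_simps)
qed

lemma single_crossing_kernel_bound: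
  fixes p v t h h' :: real
  assumes "v < h" "t < h" "h \<le> h'" and "v < t \<Longrightarrow> p \<le> 0" and "t < v \<Longrightarrow> 0 \<le> p"
  shows "sqrt ((h' - t) / (h - t)) * (p * sqrt (2 * (h - v))) \<le> p * sqrt (2 * (h' - v))"
proof -
  define R where "R w = sqrt ((h' - w) / (h - w))" for w
  have "0 \<le> p * (R v - R t)"
  proof (cases v t rule: linorder_cases)
    case less
    then have "R v \<le> R t"
      unfolding R_def using kernel_ratio_mono[of v t h h'] assms by simp
    with less assms show ?thesis by (simp add: mult_nonpos_nonpos)
  next
    case greater
    then have "R t \<le> R v"
      unfolding R_def using kernel_ratio_mono[of t v h h'] assms by simp
    with greater assms show ?thesis by simp
  qed simp
  then have "0 \<le> p * (R v - R t) * sqrt (2 * (h - v))"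
    using assms by simp
  then show ?thesis
    unfolding sqrt_kernel_factor[OF \<open>v < h\<close>, of h'] by (simp add: R_def algebra_simps)
qed

lemma single_crossing_point:
  fixes P :: "real \<Rightarrow> real"
  assumes "s \<in> {a..<h}" "0 < P s"
    and crossing: "\<And>v w. a \<le> v \<Longrightarrow> v \<le> w \<Longrightarrow> w \<le> h' \<Longrightarrow> 0 < P v \<Longrightarrow> 0 \<le> P w"
  obtains t where "a \<le> t" "t < h" "\<And>v. a \<le> v \<Longrightarrow> v < t \<Longrightarrow> P v \<le> 0"
    "\<And>v. t < v \<Longrightarrow> v \<le> h' \<Longrightarrow> 0 \<le> P v"
proof
  define S where "S = {v \<in> {a..<h}. 0 < P v}"
  have "s \<in> S" and bdd: "bdd_below S"
    using assms by (auto simp: S_def intro: bdd_belowI[of _ a])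
  then have "S \<noteq> {}" by blast
  show "a \<le> Inf S"
    by (rule cInf_greatest[OF \<open>S \<noteq> {}\<close>]) (simp add: S_def)
  show "Inf S < h"
    using cInf_lower[OF \<open>s \<in> S\<close> bdd] assms by simp
  show "P v \<le> 0" if "a \<le> v" "v < Inf S" for v
  proof (rule ccontr)
    assume "\<not> P v \<le> 0"
    then have "v \<in> S"
      using that \<open>Inf S < h\<close> by (simp add: S_def)
    then have "Inf S \<le> v"
      using bdd by (rule cInf_lower)
    with that show False by simp
  qed
  show "0 \<le> P v" if "Inf S < v" "v \<le> h'" for v
  proof -
    obtain w where "w \<in> S" "w < v"
      using \<open>Inf S < v\<close> cInf_less_iff[OF \<open>S \<noteq> {}\<close> bdd] by auto
    then show ?thesis
      using crossing[of w v] that by (simp add: S_def)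
  qed
qed

lemma kernel_integral_pos_imp_ex_pos:
  fixes P :: "real \<Rightarrow> real"
  assumes "((\<lambda>v. P v * sqrt (2 * (h - v))) has_integral I) {a..h}" "0 < I"
  shows "\<exists>s \<in> {a..<h}. 0 < P s"
proof (rule ccontr)
  assume "\<not> ?thesis"
  then have "P v * sqrt (2 * (h - v)) \<le> 0" if "v \<in> {a..h}" for v
    using that by (cases "v = h") (auto intro: mult_nonpos_nonneg simp: not_less)
  then have "I \<le> 0"
    using has_integral_le[OF assms(1) has_integral_0] by simp
  with \<open>0 < I\<close> show False by simp
qed

lemma single_crossing_kernel_integral_nonneg:
  fixes P :: "real \<Rightarrow> real"
  assumes "h \<le> h'"
    and I: "((\<lambda>v. P v * sqrt (2 * (h - v))) has_integral I) {a..h}" and "0 < I"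
    and int: "(\<lambda>v. P v * sqrt (2 * (h' - v))) integrable_on {a..h'}"
    and crossing: "\<And>v w. a \<le> v \<Longrightarrow> v \<le> w \<Longrightarrow> w \<le> h' \<Longrightarrow> 0 < P v \<Longrightarrow> 0 \<le> P w"
  shows "0 \<le> integral {a..h'} (\<lambda>v. P v * sqrt (2 * (h' - v)))"
proof -
  obtain s where "s \<in> {a..<h}" "0 < P s"
    using kernel_integral_pos_imp_ex_pos[OF I \<open>0 < I\<close>] by blast
  then obtain t where t: "a \<le> t" "t < h" and below: "\<And>v. a \<le> v \<Longrightarrow> v < t \<Longrightarrow> P v \<le> 0"
    and above: "\<And>v. t < v \<Longrightarrow> v \<le> h' \<Longrightarrow> 0 \<le> P v"
    using single_crossing_point[of s a h P h'] crossing by blast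
  define r where "r = sqrt ((h' - t) / (h - t))"
  have "0 \<le> r"
    using t \<open>h \<le> h'\<close> by (simp add: r_def)
  let ?K = "\<lambda>v. P v * sqrt (2 * (h' - v))"
  have "r * I \<le> integral {a..h} ?K"
  proof (rule has_integral_le[OF has_integral_mult_right[OF I] integrable_integral])
    show "?K integrable_on {a..h}"
      by (rule integrable_on_subinterval[OF int]) (use \<open>h \<le> h'\<close> in auto)
    show "r * (P v * sqrt (2 * (h - v))) \<le> ?K v" if "v \<in> {a..h}" for v
    proof (cases "v = h")
      case True
      then show ?thesis using above[of h] t \<open>h \<le> h'\<close> by simp
    next
      case False
      then show ?thesis
        unfolding r_def using that t \<open>h \<le> h'\<close> below[of v] above[of v]
        by (intro single_crossing_kernel_bound) auto
    qed
  qed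
  moreover have "0 \<le> integral {h..h'} ?K"
  proof (rule integral_nonneg)
    show "?K integrable_on {h..h'}"
      by (rule integrable_on_subinterval[OF int]) (use t in auto)
    show "0 \<le> ?K v" if "v \<in> {h..h'}" for v
      using that t above[of v] by simp
  qed
  moreover have "integral {a..h} ?K + integral {h..h'} ?K = integral {a..h'} ?K"
    by (rule Henstock_Kurzweil_Integration.integral_combine) (use t \<open>h \<le> h'\<close> int in auto)
  moreover have "0 \<le> r * I"
    using \<open>0 \<le> r\<close> \<open>0 < I\<close> by simp
  ultimately show ?thesis
    by linarith
qed

lemma connected_component_set_eq_Ioo:
  fixes S :: "real set"
  assumes "{a<..<b} \<subseteq> S" "a \<notin> S" "b \<notin> S" "x \<in> {a<..<b}"
  shows "connected_component_set S x = {a<..<b}"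
proof
  let ?C = "connected_component_set S x"
  show "{a<..<b} \<subseteq> ?C"
    by (rule connected_component_maximal) (use assms in auto)
  then have "x \<in> ?C"
    using assms by blast
  have "a \<notin> ?C" "b \<notin> ?C"
    using connected_component_subset assms by blast+
  have between: "z \<in> ?C" if "y \<in> ?C" "y' \<in> ?C" "y \<le> z" "z \<le> y'" for y y' z
    using connected_connected_component[of S x] that unfolding connected_iff_interval by blast
  show "?C \<subseteq> {a<..<b}"
  proof
    fix y
    assume "y \<in> ?C"
    have "a < y"
    proof (rule ccontr)
      assume "\<not> a < y"
      then have "a \<in> ?C"
        using between[OF \<open>y \<in> ?C\<close> \<open>x \<in> ?C\<close>, of a] assms(4) by simp
      with \<open>a \<notin> ?C\<close> show False ..
    qed
    moreover have "y < b"
    proof (rule ccontr)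
      assume "\<not> y < b"
      then have "b \<in> ?C"
        using between[OF \<open>x \<in> ?C\<close> \<open>y \<in> ?C\<close>, of b] assms(4) by simp
      with \<open>b \<notin> ?C\<close> show False ..
    qed
    ultimately show "y \<in> {a<..<b}"
      by simp
  qed
qed

locale quartic_center =
  fixes \<beta> k u0 :: real
  assumes beta_pos: "0 < \<beta>" and u0_pos: "0 < u0" and u0_less_k: "u0 < k"
    and k_le_2u0: "k \<le> 2 * u0"
begin

abbreviation V :: "real \<Rightarrow> real" where
  "V \<equiv> hpot \<beta> k u0"

definition dV :: "real \<Rightarrow> real" where
  "dV u = \<beta> * u * (u - u0) * (k - u)"

lemma V_has_real_derivative: "(V has_real_derivative dV u) (at u)"
proof -
  have "(V has_real_derivative \<beta> * ((k + u0) * u ^ 2 - u ^ 3 - k * u0 * u)) (at u)"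
    unfolding hpot_def by (auto intro!: derivative_eq_intros)
  moreover have "\<beta> * ((k + u0) * u ^ 2 - u ^ 3 - k * u0 * u) = dV u"
    unfolding dV_def by algebra
  ultimately show ?thesis by simp
qed

lemma continuous_on_V: "continuous_on S V"
  unfolding hpot_def by (intro continuous_intros) auto

lemma dV_neg: "0 < u \<Longrightarrow> u < u0 \<Longrightarrow> dV u < 0"
  unfolding dV_def using beta_pos u0_less_k by (simp add: mult_pos_neg mult_neg_pos)

lemma dV_pos: "u0 < u \<Longrightarrow> u < k \<Longrightarrow> 0 < dV u"
  unfolding dV_def using beta_pos u0_pos by simp

lemma V_strict_antimono: "0 \<le> x \<Longrightarrow> x < y \<Longrightarrow> y \<le> u0 \<Longrightarrow> V y < V x"
  using DERIV_neg_imp_decreasing_open[of x y V] V_has_real_derivative dV_neg continuous_on_V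
  by force

lemma V_strict_mono: "u0 \<le> x \<Longrightarrow> x < y \<Longrightarrow> y \<le> k \<Longrightarrow> V x < V y"
  using DERIV_pos_imp_increasing_open[of x y V] V_has_real_derivative dV_pos continuous_on_V
  by force

lemma V_reflect: "V (u0 + x) - V (u0 - x) = 2 / 3 * (\<beta> * (k - 2 * u0) * x ^ 3)"
  unfolding hpot_def by (simp add: field_simps eval_nat_numeral)

lemma V_reflect_less:
  assumes "k < 2 * u0" "0 < x"
  shows "V (u0 + x) < V (u0 - x)"
proof -
  have "\<beta> * (k - 2 * u0) * x ^ 3 < 0"
    using assms beta_pos by (intro mult_neg_pos mult_pos_neg) auto
  then show ?thesis
    using V_reflect[of x] by linarith
qed

lemma V_eq_imp_product_sum_eq:
  assumes "V a = V b" "a \<noteq> b"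
  shows "a * b * (6 * (a + b) - 4 * (k + u0))
    = (a + b) * (3 * (a + b) ^ 2 - 4 * (k + u0) * (a + b) + 6 * k * u0)"
proof -
  have "V a - V b = \<beta> * (a - b) / 12 * (a * b * (6 * (a + b) - 4 * (k + u0))
      - (a + b) * (3 * (a + b) ^ 2 - 4 * (k + u0) * (a + b) + 6 * k * u0))"
    unfolding hpot_def by (simp add: field_simps) algebra
  then show ?thesis
    using assms beta_pos by simp
qed

definition h1 :: real where "h1 = V u0"
definition h2 :: real where "h2 = V k"

lemma h1_eq: "h1 = \<beta> * u0 ^ 3 / 12 * (u0 - 2 * k)"
  unfolding h1_def hpot_def by (simp add: field_simps eval_nat_numeral)

lemma h2_eq: "h2 = \<beta> * k ^ 3 / 12 * (k - 2 * u0)"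
  unfolding h2_def hpot_def by (simp add: field_simps eval_nat_numeral)

lemma h2_nonpos: "h2 \<le> 0"
  unfolding h2_eq using beta_pos u0_less_k u0_pos k_le_2u0 by (simp add: mult_nonneg_nonpos)

lemma V_0: "V 0 = 0"
  by (simp add: hpot_def)

lemma inj_on_V_left: "inj_on V {0..u0}"
proof (rule inj_onI)
  fix x y
  assume "x \<in> {0..u0}" "y \<in> {0..u0}" "V x = V y"
  then show "x = y"
    using V_strict_antimono[of x y] V_strict_antimono[of y x] by (cases x y rule: linorder_cases) auto
qed

lemma inj_on_V_right: "inj_on V {u0..k}"
proof (rule inj_onI)
  fix x y
  assume "x \<in> {u0..k}" "y \<in> {u0..k}" "V x = V y"
  then show "x = y"
    using V_strict_mono[of x y] V_strict_mono[of y x] by (cases x y rule: linorder_cases) auto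
qed

lemma V_image_left: "V ` {0..u0} = {h1..0}"
proof
  show "V ` {0..u0} \<subseteq> {h1..0}"
  proof
    fix v
    assume "v \<in> V ` {0..u0}"
    then obtain u where "u \<in> {0..u0}" "v = V u"
      by blast
    then show "v \<in> {h1..0}"
      unfolding h1_def using V_strict_antimono[of u u0] V_strict_antimono[of 0 u] V_0
      by (cases "u = u0"; cases "u = 0") auto
  qed
  show "{h1..0} \<subseteq> V ` {0..u0}"
  proof
    fix v
    assume "v \<in> {h1..0}"
    then obtain u where "u \<in> {0..u0}" "V u = v"
      using IVT2'[of V u0 v 0] continuous_on_V u0_pos V_0 unfolding h1_def by auto
    then show "v \<in> V ` {0..u0}"
      by blast
  qed
qed

lemma V_image_right: "V ` {u0..k} = {h1..h2}"
proof
  show "V ` {u0..k} \<subseteq> {h1..h2}"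
  proof
    fix v
    assume "v \<in> V ` {u0..k}"
    then obtain u where "u \<in> {u0..k}" "v = V u"
      by blast
    then show "v \<in> {h1..h2}"
      unfolding h1_def h2_def using V_strict_mono[of u0 u] V_strict_mono[of u k]
      by (cases "u = u0"; cases "u = k") auto
  qed
  show "{h1..h2} \<subseteq> V ` {u0..k}"
  proof
    fix v
    assume "v \<in> {h1..h2}"
    then obtain u where "u \<in> {u0..k}" "V u = v"
      using IVT'[of V u0 v k] continuous_on_V u0_less_k unfolding h1_def h2_def by auto
    then show "v \<in> V ` {u0..k}"
      by blast
  qed
qed

definition uL :: "real \<Rightarrow> real" where
  "uL = the_inv_into {0..u0} V"

definition uR :: "real \<Rightarrow> real" where
  "uR = the_inv_into {u0..k} V"

lemma levels_left: "{h1..h2} \<subseteq> V ` {0..u0}"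
  using V_image_left h2_nonpos by auto

lemma uL_mem: "v \<in> {h1..h2} \<Longrightarrow> uL v \<in> {0..u0}"
  unfolding uL_def using levels_left by (blast intro: the_inv_into_into inj_on_V_left)

lemma uR_mem: "v \<in> {h1..h2} \<Longrightarrow> uR v \<in> {u0..k}"
  unfolding uR_def using V_image_right by (blast intro: the_inv_into_into inj_on_V_right)

lemma V_uL: "v \<in> {h1..h2} \<Longrightarrow> V (uL v) = v"
  unfolding uL_def using levels_left by (blast intro: f_the_inv_into_f inj_on_V_left)

lemma V_uR: "v \<in> {h1..h2} \<Longrightarrow> V (uR v) = v"
  unfolding uR_def using V_image_right by (blast intro: f_the_inv_into_f inj_on_V_right)

lemma uL_V: "u \<in> {0..u0} \<Longrightarrow> uL (V u) = u"
  unfolding uL_def by (rule the_inv_into_f_f[OF inj_on_V_left])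

lemma uR_V: "u \<in> {u0..k} \<Longrightarrow> uR (V u) = u"
  unfolding uR_def by (rule the_inv_into_f_f[OF inj_on_V_right])

lemma uL_h1: "uL h1 = u0"
  unfolding h1_def using uL_V u0_pos by simp

lemma uR_h1: "uR h1 = u0"
  unfolding h1_def using uR_V u0_less_k by simp

lemma turning_points_strict:
  assumes "h1 < v" "v < h2"
  shows "0 < uL v" "uL v < u0" "u0 < uR v" "uR v < k"
proof -
  have v: "v \<in> {h1..h2}" and "v \<noteq> 0"
    using assms h2_nonpos by auto
  note L = uL_mem[OF v] V_uL[OF v] and R = uR_mem[OF v] V_uR[OF v]
  show "0 < uL v"
    using L V_0 \<open>v \<noteq> 0\<close> by (cases "uL v = 0") auto
  show "uL v < u0"
    using L assms unfolding h1_def by (cases "uL v = u0") auto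
  show "u0 < uR v"
    using R assms unfolding h1_def by (cases "uR v = u0") auto
  show "uR v < k"
    using R assms unfolding h2_def by (cases "uR v = k") auto
qed

lemma uL_strict_antimono:
  assumes "h1 \<le> v" "v < v'" "v' \<le> h2"
  shows "uL v' < uL v"
proof (rule ccontr)
  assume "\<not> uL v' < uL v"
  then consider "uL v = uL v'" | "uL v < uL v'"
    by linarith
  then show False
    using uL_mem[of v] uL_mem[of v'] V_uL[of v] V_uL[of v'] V_strict_antimono[of "uL v" "uL v'"] assms
    by cases auto
qed

lemma uR_strict_mono:
  assumes "h1 \<le> v" "v < v'" "v' \<le> h2"
  shows "uR v < uR v'"
proof (rule ccontr)
  assume "\<not> uR v < uR v'"
  then consider "uR v = uR v'" | "uR v' < uR v"
    by linarith
  then show False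
    using uR_mem[of v] uR_mem[of v'] V_uR[of v] V_uR[of v'] V_strict_mono[of "uR v'" "uR v"] assms
    by cases auto
qed

lemma continuous_on_uL: "continuous_on {h1..h2} uL"
  using continuous_on_inv_into[OF continuous_on_V compact_Icc inj_on_V_left]
  unfolding uL_def by (rule continuous_on_subset) (rule levels_left)

lemma continuous_on_uR: "continuous_on {h1..h2} uR"
  using continuous_on_inv_into[OF continuous_on_V compact_Icc inj_on_V_right]
  unfolding uR_def V_image_right .

lemma uL_has_real_derivative:
  assumes "h1 < v" "v < h2"
  shows "(uL has_real_derivative inverse (dV (uL v))) (at v)"
proof (rule DERIV_inverse_function[where f = V and a = h1 and b = h2])
  show "dV (uL v) \<noteq> 0"
    using dV_neg turning_points_strict[OF assms] by force
  show "isCont uL v"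
    using continuous_on_interior[OF continuous_on_uL] assms by auto
qed (use assms V_uL V_has_real_derivative in auto)

lemma uR_has_real_derivative:
  assumes "h1 < v" "v < h2"
  shows "(uR has_real_derivative inverse (dV (uR v))) (at v)"
proof (rule DERIV_inverse_function[where f = V and a = h1 and b = h2])
  show "dV (uR v) \<noteq> 0"
    using dV_pos turning_points_strict[OF assms] by force
  show "isCont uR v"
    using continuous_on_interior[OF continuous_on_uR] assms by auto
qed (use assms V_uR V_has_real_derivative in auto)

lemma V_less_level:
  assumes "h1 < h" "h < h2" "uL h < u" "u < uR h"
  shows "V u < h"
proof (cases "u \<le> u0")
  case True
  then have "V u < V (uL h)"
    using V_strict_antimono[of "uL h" u] turning_points_strict[OF assms(1,2)] assms by auto
  then show ?thesis
    using V_uL assms by simp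
next
  case False
  then have "V u < V (uR h)"
    using V_strict_mono[of u "uR h"] turning_points_strict[OF assms(1,2)] assms by auto
  then show ?thesis
    using V_uR assms by simp
qed

lemma V_le_level:
  assumes "h1 < h" "h < h2" "uL h \<le> u" "u \<le> uR h"
  shows "V u \<le> h"
proof (cases "u = uL h \<or> u = uR h")
  case True
  then show ?thesis
    using V_uL[of h] V_uR[of h] assms by auto
next
  case False
  then show ?thesis
    using V_less_level[of h u] assms by (auto simp: less_le)
qed

lemma oval_base_eq:
  assumes "h1 < h" "h < h2"
  shows "oval_base \<beta> k u0 h = {uL h<..<uR h}"
  unfolding oval_base_def
proof (rule connected_component_set_eq_Ioo)
  show "{uL h<..<uR h} \<subseteq> {u. V u < h}"
    using V_less_level assms by auto
qed (use assms V_uL V_uR turning_points_strict[OF assms] in auto)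

definition abel_density :: "nat \<Rightarrow> real \<Rightarrow> real" where
  "abel_density m v = uR v ^ m / dV (uR v) - uL v ^ m / dV (uL v)"

lemma oval_integral_eq:
  assumes "h1 < h" "h < h2"
  shows "oval_integral \<beta> k u0 m h = 2 * integral {uL h..uR h} (\<lambda>u. u ^ m * sqrt (2 * (h - V u)))"
  unfolding oval_integral_def oval_base_eq[OF assms] by (simp add: integral_open_interval_real)

lemma branch_substitution:
  assumes "h1 < h" "h < h2" and F: "continuous_on {0..k} F"
    and cont: "continuous_on {h1..h2} X" and img: "X ` {h1..h2} \<subseteq> {0..k}"
    and deriv: "\<And>v. h1 < v \<Longrightarrow> v < h2 \<Longrightarrow> (X has_real_derivative inverse (dV (X v))) (at v)"
  shows "((\<lambda>v. inverse (dV (X v)) * F (X v)) has_integral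
    integral {X h1..X h} F - integral {X h..X h1} F) {h1..h}"
proof -
  have "((\<lambda>v. inverse (dV (X v)) *\<^sub>R F (X v)) has_integral
      integral {X h1..X h} F - integral {X h..X h1} F) {h1..h}"
  proof (rule has_integral_substitution_general[of "{h1}"])
    show "X ` {h1..h} \<subseteq> {0..k}"
      using img assms by auto
    show "continuous_on {h1..h} X"
      using cont by (rule continuous_on_subset) (use assms in auto)
    show "(X has_real_derivative inverse (dV (X v))) (at v within {h1..h})"
      if "v \<in> {h1..h} - {h1}" for v
      using deriv[of v] that assms by (auto intro: has_field_derivative_at_within)
  qed (use assms F in auto)
  then show ?thesis
    by simp
qed

lemma oval_integral_abel:
  assumes "h1 < h" "h < h2"
  shows "((\<lambda>v. abel_density m v * sqrt (2 * (h - v))) has_integral oval_integral \<beta> k u0 m h / 2)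
    {h1..h}"
proof -
  define F where "F = (\<lambda>u. u ^ m * sqrt (2 * (h - V u)))"
  have F: "continuous_on {0..k} F"
    unfolding F_def hpot_def by (intro continuous_intros) auto
  have "uR ` {h1..h2} \<subseteq> {0..k}" "uL ` {h1..h2} \<subseteq> {0..k}"
    using uR_mem uL_mem u0_pos u0_less_k by fastforce+
  note turning = turning_points_strict[OF assms]
  have right: "((\<lambda>v. inverse (dV (uR v)) * F (uR v)) has_integral integral {u0..uR h} F) {h1..h}"
    using branch_substitution[OF assms F continuous_on_uR \<open>uR ` {h1..h2} \<subseteq> {0..k}\<close>
        uR_has_real_derivative] turning
    by (simp add: uR_h1)
  have left: "((\<lambda>v. inverse (dV (uL v)) * F (uL v)) has_integral - integral {uL h..u0} F) {h1..h}"
    using branch_substitution[OF assms F continuous_on_uL \<open>uL ` {h1..h2} \<subseteq> {0..k}\<close>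
        uL_has_real_derivative] turning
    by (simp add: uL_h1)
  have "F integrable_on {uL h..uR h}"
    using F turning by (intro integrable_continuous_real) (auto elim: continuous_on_subset)
  then have combine: "integral {uL h..u0} F + integral {u0..uR h} F = integral {uL h..uR h} F"
    using turning by (intro Henstock_Kurzweil_Integration.integral_combine) auto
  have "inverse (dV (uR v)) * F (uR v) - inverse (dV (uL v)) * F (uL v)
      = abel_density m v * sqrt (2 * (h - v))" if "v \<in> {h1..h}" for v
    using that assms V_uL[of v] V_uR[of v]
    by (simp add: F_def abel_density_def divide_inverse algebra_simps)
  from has_integral_eq[OF this has_integral_diff[OF right left]]
  show ?thesis
    using combine oval_integral_eq[OF assms, of m] by (simp add: F_def add.commute)
qed

lemma oval_integral_0_pos:
  assumes "h1 < h" "h < h2"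
  shows "0 < oval_integral \<beta> k u0 0 h"
proof -
  define h0 where "h0 = (h1 + h) / 2"
  have h0: "h1 < h0" "h0 < h"
    using assms by (auto simp: h0_def)
  define F where "F = (\<lambda>u. sqrt (2 * (h - V u)))"
  have intF: "F integrable_on {a..b}" for a b
    unfolding F_def hpot_def by (intro integrable_continuous_real continuous_intros) auto
  note turning0 = turning_points_strict[of h0]
  have "0 < (uR h0 - uL h0) * sqrt (2 * (h - h0))"
    using turning0 h0 assms by simp
  also have "\<dots> = integral {uL h0..uR h0} (\<lambda>u. sqrt (2 * (h - h0)))"
    using turning0 h0 assms by simp
  also have "\<dots> \<le> integral {uL h0..uR h0} F"
    using V_le_level[of h0] h0 assms intF by (intro integral_le) (auto simp: F_def)
  also have "\<dots> \<le> integral {uL h..uR h} F"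
    using uL_strict_antimono[of h0 h] uR_strict_mono[of h0 h] V_le_level[OF assms] h0 assms intF
    by (intro integral_subset_le) (auto simp: F_def)
  also have "\<dots> = oval_integral \<beta> k u0 0 h / 2"
    using oval_integral_eq[OF assms, of 0] by (simp add: F_def)
  finally show ?thesis
    by simp
qed

definition turning_mean :: "nat \<Rightarrow> real \<Rightarrow> real" where
  "turning_mean m v = (uR v ^ m * - dV (uL v) + uL v ^ m * dV (uR v)) / (- dV (uL v) + dV (uR v))"

lemma dV_turning_points:
  assumes "h1 < v" "v < h2"
  shows "dV (uL v) < 0" "0 < dV (uR v)"
  using dV_neg dV_pos turning_points_strict[OF assms] by auto

lemma abel_density_0_pos:
  assumes "h1 < v" "v < h2"
  shows "0 < abel_density 0 v"
proof -
  have "1 / dV (uL v) < 0" "0 < 1 / dV (uR v)"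
    using dV_turning_points[OF assms] by simp_all
  then show ?thesis
    unfolding abel_density_def power_0 by linarith
qed

lemma abel_density_eq_turning_mean:
  assumes "h1 < v" "v < h2"
  shows "abel_density m v = turning_mean m v * abel_density 0 v"
  using dV_turning_points[OF assms]
  by (simp add: abel_density_def turning_mean_def field_simps)

text \<open>This holds only because \<open>inverse 0 = 0\<close>: the true density is unbounded near \<open>h1\<close>,
  but a single point does not affect the integrals.\<close>

lemma abel_density_h1: "abel_density m h1 = 0"
  by (simp add: abel_density_def uL_h1 uR_h1 dV_def)

text \<open>Eliminating \<open>a * b\<close> from \<open>V a = V b\<close> by \<open>V_eq_imp_product_sum_eq\<close> expresses the
  weighted mean of \<open>a\<close> and \<open>b\<close> in \<open>turning_mean 1\<close> as \<open>sum_mean (a + b)\<close>.\<close>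

definition mean_num :: "real \<Rightarrow> real" where
  "mean_num s = (s - 2 * u0) * (s - k) * (3 * s ^ 2 - 4 * (k + u0) * s + 2 * (k + u0) * u0)"

definition mean_den :: "real \<Rightarrow> real" where
  "mean_den s = 3 * s ^ 3 - 6 * (k + u0) * s ^ 2 + 4 * (k + u0) ^ 2 * s - 4 * (k + u0) * k * u0"

definition sum_mean :: "real \<Rightarrow> real" where
  "sum_mean s = u0 + mean_num s / mean_den s"

definition mean_num' :: "real \<Rightarrow> real" where
  "mean_num' s = 12 * s ^ 3 - 21 * s ^ 2 * k - 30 * s ^ 2 * u0 + 8 * s * k ^ 2
    + 40 * s * k * u0 + 20 * s * u0 ^ 2 - 10 * k ^ 2 * u0 - 14 * k * u0 ^ 2 - 4 * u0 ^ 3"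

definition mean_den' :: "real \<Rightarrow> real" where
  "mean_den' s = 9 * s ^ 2 - 12 * (k + u0) * s + 4 * (k + u0) ^ 2"

lemma mean_num_has_real_derivative: "(mean_num has_real_derivative mean_num' s) (at s)"
proof -
  have "(mean_num has_real_derivative (1 * (s - k) + (s - 2 * u0) * 1)
      * (3 * s ^ 2 - 4 * (k + u0) * s + 2 * (k + u0) * u0)
      + (s - 2 * u0) * (s - k) * (3 * (2 * s) - 4 * (k + u0))) (at s)"
    unfolding mean_num_def by (auto intro!: derivative_eq_intros)
  then show ?thesis
    by (rule DERIV_cong) (simp only: mean_num'_def; algebra)
qed

lemma mean_den_has_real_derivative: "(mean_den has_real_derivative mean_den' s) (at s)"
proof -
  have "(mean_den has_real_derivative 3 * (3 * s ^ 2) - 6 * (k + u0) * (2 * s) + 4 * (k + u0) ^ 2)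
      (at s)"
    unfolding mean_den_def by (auto intro!: derivative_eq_intros)
  then show ?thesis
    by (rule DERIV_cong) (simp only: mean_den'_def; algebra)
qed

lemma sum_mean_has_real_derivative:
  assumes "mean_den s \<noteq> 0"
  shows "(sum_mean has_real_derivative
    (mean_num' s * mean_den s - mean_num s * mean_den' s) / mean_den s ^ 2) (at s)"
  using DERIV_add[OF DERIV_const DERIV_divide[OF mean_num_has_real_derivative
      mean_den_has_real_derivative assms], of u0]
  unfolding sum_mean_def[abs_def] by (simp add: power2_eq_square)

lemma sum_mean_deriv_numerator_nonneg:
  assumes "2 * u0 \<le> s" "s \<le> u0 + k"
  shows "0 \<le> mean_num' s * mean_den s - mean_num s * mean_den' s"
proof -
  \<comment> \<open>In these coordinates the numerator becomes a polynomial with positive coefficients.\<close>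
  define x z w where "x = s - 2 * u0" and "z = u0 + k - s" and "w = 2 * u0 - k"
  have "0 \<le> x" "0 \<le> z" "0 \<le> w"
    using assms k_le_2u0 by (auto simp: x_def z_def w_def)
  have subst: "u0 = x + z + w" "k = 2 * x + 2 * z + w" "s = 3 * x + 2 * z + 2 * w"
    by (auto simp: x_def z_def w_def)
  have "mean_num' s * mean_den s - mean_num s * mean_den' s
    = 24*z^2*w^4 + 48*z^3*w^3 + 24*z^4*w^2 + 16*x*z*w^4 + 160*x*z^2*w^3 + 192*x*z^3*w^2
      + 48*x*z^4*w + 8*x^2*w^4 + 104*x^2*z*w^3 + 360*x^2*z^2*w^2 + 192*x^2*z^3*w
      + 48*x^3*w^3 + 228*x^3*z*w^2 + 276*x^3*z^2*w + 102*x^4*w^2 + 186*x^4*z*w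
      + 18*x^4*z^2 + 90*x^5*w + 36*x^5*z + 27*x^6"
    unfolding mean_num'_def mean_den'_def mean_num_def mean_den_def unfolding subst by algebra
  with \<open>0 \<le> x\<close> \<open>0 \<le> z\<close> \<open>0 \<le> w\<close> show ?thesis
    by simp
qed

lemma turning_sum_ge:
  assumes "k < 2 * u0" "h1 < v" "v < h2"
  shows "2 * u0 \<le> uL v + uR v"
proof (rule ccontr)
  assume "\<not> 2 * u0 \<le> uL v + uR v"
  note turning = turning_points_strict[OF assms(2,3)]
  have v: "v \<in> {h1..h2}"
    using assms by simp
  define x where "x = u0 - uL v"
  have "0 < x"
    using turning by (simp add: x_def)
  have "V (u0 + x) < V (u0 - x)"
    using V_reflect_less[OF assms(1) \<open>0 < x\<close>] .
  also have "V (u0 - x) = v"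
    using V_uL[OF v] by (simp add: x_def)
  finally have "V (u0 + x) < v" .
  show False
  proof (cases "u0 + x \<le> k")
    case True
    then have "V (uR v) < V (u0 + x)"
      using V_strict_mono[of "uR v" "u0 + x"] turning \<open>\<not> 2 * u0 \<le> uL v + uR v\<close>
      by (simp add: x_def)
    with \<open>V (u0 + x) < v\<close> V_uR[OF v] show False
      by simp
  next
    case False
    then have "V (2 * u0 - k) < V (uL v)"
      using V_strict_antimono[of "uL v" "2 * u0 - k"] turning u0_less_k by (simp add: x_def)
    moreover have "V (u0 + (k - u0)) < V (u0 - (k - u0))"
      by (rule V_reflect_less[OF assms(1)]) (use u0_less_k in simp)
    ultimately show False
      using V_uL[OF v] assms unfolding h2_def by simp
  qed
qed

lemma turning_mean_1_eq_sum_mean: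
  assumes "k < 2 * u0" "h1 < v" "v < h2"
  shows "turning_mean 1 v = sum_mean (uL v + uR v)" and "mean_den (uL v + uR v) < 0"
proof -
  define a b where "a = uL v" and "b = uR v"
  define s where "s = a + b"
  define M where "M = a * b + (k + u0) * s - k * u0 - s ^ 2"
  note turning = turning_points_strict[OF assms(2,3)]
  have C: "a * b * (6 * s - 4 * (k + u0)) = s * (3 * s ^ 2 - 4 * (k + u0) * s + 6 * k * u0)"
    using V_eq_imp_product_sum_eq[of a b] V_uL[of v] V_uR[of v] turning assms
    by (simp add: a_def b_def s_def)
  have p: "dV a < 0" and q: "0 < dV b"
    using dV_turning_points[OF assms(2,3)] by (simp_all add: a_def b_def)
  have pq: "- dV a + dV b = \<beta> * (b - a) * M"
    unfolding dV_def M_def s_def by algebra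
  have "0 < \<beta> * (b - a)"
    using beta_pos turning by (simp add: a_def b_def)
  with pq p q have "0 < M"
    by (metis add_pos_pos neg_0_less_iff_less zero_less_mult_pos)
  have "0 < 6 * s - 4 * (k + u0)"
    using turning_sum_ge[OF assms] assms(1) by (simp add: s_def a_def b_def)
  have "mean_den s = - M * (6 * s - 4 * (k + u0))"
    using C unfolding mean_den_def M_def by algebra
  with \<open>0 < M\<close> \<open>0 < 6 * s - 4 * (k + u0)\<close> have "mean_den s < 0"
    by simp
  then show "mean_den (uL v + uR v) < 0"
    by (simp add: s_def a_def b_def)
  have "(b * - dV a + a * dV b) * mean_den s = (u0 * mean_den s + mean_num s) * (- dV a + dV b)"
    using C unfolding dV_def mean_den_def mean_num_def s_def by algebra
  with p q \<open>mean_den s < 0\<close> have "(b * - dV a + a * dV b) / (- dV a + dV b) = sum_mean s"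
    unfolding sum_mean_def by (simp add: field_simps)
  then show "turning_mean 1 v = sum_mean (uL v + uR v)"
    by (simp add: turning_mean_def a_def b_def s_def)
qed

lemma turning_sum_deriv_nonneg:
  assumes "k < 2 * u0" "h1 < v" "v < h2"
  shows "0 \<le> inverse (dV (uL v)) + inverse (dV (uR v))"
proof -
  define a b where "a = uL v" and "b = uR v"
  define s where "s = a + b"
  note turning = turning_points_strict[OF assms(2,3)]
  have C: "a * b * (6 * s - 4 * (k + u0)) = s * (3 * s ^ 2 - 4 * (k + u0) * s + 6 * k * u0)"
    using V_eq_imp_product_sum_eq[of a b] V_uL[of v] V_uR[of v] turning assms
    by (simp add: a_def b_def s_def)
  have p: "dV a < 0" and q: "0 < dV b"
    using dV_turning_points[OF assms(2,3)] by (simp_all add: a_def b_def)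
  have "2 * u0 \<le> s"
    using turning_sum_ge[OF assms] by (simp add: s_def a_def b_def)
  then have "0 < 6 * s - 4 * (k + u0)"
    using assms(1) by simp
  moreover have "(dV a + dV b) * (6 * s - 4 * (k + u0))
      = (- \<beta> * s * (s - 2 * u0) * (2 * k - s) / 2) * (6 * s - 4 * (k + u0))"
    using C unfolding dV_def s_def by algebra
  ultimately have "dV a + dV b = - \<beta> * s * (s - 2 * u0) * (2 * k - s) / 2"
    by (metis mult_right_cancel less_irrefl)
  moreover have "0 \<le> \<beta> * s * (s - 2 * u0) * (2 * k - s)"
    using beta_pos turning \<open>2 * u0 \<le> s\<close> by (simp add: s_def a_def b_def)
  ultimately have "dV a + dV b \<le> 0"
    by simp
  moreover have "inverse (dV a) + inverse (dV b) = (dV a + dV b) / (dV a * dV b)"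
    using p q by (simp add: field_simps)
  ultimately show ?thesis
    using p q by (simp add: a_def b_def divide_nonpos_neg mult_neg_pos)
qed

lemma turning_mean_1_mono_asym:
  assumes "k < 2 * u0" "h1 < v" "v \<le> v'" "v' < h2"
  shows "turning_mean 1 v \<le> turning_mean 1 v'"
proof -
  have "sum_mean (uL v + uR v) \<le> sum_mean (uL v' + uR v')"
  proof (rule DERIV_nonneg_imp_nondecreasing[OF \<open>v \<le> v'\<close>])
    fix x
    assume "v \<le> x" "x \<le> v'"
    then have x: "h1 < x" "x < h2"
      using assms by auto
    define s where "s = uL x + uR x"
    have "2 * u0 \<le> s" "s \<le> u0 + k"
      using turning_sum_ge[OF assms(1) x] turning_points_strict[OF x] by (simp_all add: s_def)
    moreover have "mean_den s \<noteq> 0"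
      using turning_mean_1_eq_sum_mean(2)[OF assms(1) x] by (simp add: s_def)
    ultimately obtain d where d: "(sum_mean has_real_derivative d) (at s)" "0 \<le> d"
      using sum_mean_has_real_derivative sum_mean_deriv_numerator_nonneg by force
    have "((\<lambda>x. uL x + uR x) has_real_derivative inverse (dV (uL x)) + inverse (dV (uR x))) (at x)"
      by (intro DERIV_add uL_has_real_derivative uR_has_real_derivative x)
    from DERIV_chain2[OF d(1)[unfolded s_def] this]
    show "\<exists>y. ((\<lambda>x. sum_mean (uL x + uR x)) has_real_derivative y) (at x) \<and> 0 \<le> y"
      using d(2) turning_sum_deriv_nonneg[OF assms(1) x] by (blast intro: mult_nonneg_nonneg)
  qed
  then show ?thesis
    using turning_mean_1_eq_sum_mean(1)[OF assms(1)] assms by simp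
qed

lemma turning_mean_1_sym:
  assumes "k = 2 * u0" "h1 < v" "v < h2"
  shows "turning_mean 1 v = u0"
proof -
  note turning = turning_points_strict[OF assms(2,3)]
  define b where "b = uR v"
  have "V (2 * u0 - b) = V b"
    using V_reflect[of "b - u0"] assms(1) by simp
  then have a: "uL v = 2 * u0 - b"
    using uL_V[of "2 * u0 - b"] V_uR[of v] turning assms by (simp add: b_def)
  have "dV (uL v) = - dV b"
    unfolding a dV_def using assms(1) by algebra
  moreover have "0 < dV b"
    using dV_turning_points[OF assms(2,3)] by (simp add: b_def)
  ultimately show ?thesis
    unfolding turning_mean_def a b_def[symmetric] by (simp add: field_simps)
qed

lemma turning_mean_1_mono:
  assumes "h1 < v" "v \<le> v'" "v' < h2"
  shows "turning_mean 1 v \<le> turning_mean 1 v'"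
proof (cases "k = 2 * u0")
  case True
  then show ?thesis
    using turning_mean_1_sym assms by simp
next
  case False
  then show ?thesis
    using turning_mean_1_mono_asym k_le_2u0 assms by simp
qed

lemma turning_mean_mono:
  assumes "h1 < v" "v \<le> v'" "v' < h2"
  shows "turning_mean m v \<le> turning_mean m v'"
proof (cases "v = v'")
  case False
  with assms have "v < v'" "h1 < v'" "v < h2"
    by auto
  note turning = turning_points_strict[OF assms(1) \<open>v < h2\<close>] turning_points_strict[OF \<open>h1 < v'\<close> assms(3)]
  have "uL v' < uL v" "uR v < uR v'"
    using uL_strict_antimono[of v v'] uR_strict_mono[of v v'] \<open>v < v'\<close> assms by auto
  have "convex_on {uL v'..uR v'} (\<lambda>x. x ^ m)"
    using turning by (intro convex_on_subset[OF convex_on_nonneg_power]) auto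
  then have "(uR v ^ m * - dV (uL v) + uL v ^ m * dV (uR v)) / (- dV (uL v) + dV (uR v))
      \<le> (uR v' ^ m * - dV (uL v') + uL v' ^ m * dV (uR v')) / (- dV (uL v') + dV (uR v'))"
    using turning_mean_1_mono[OF assms] dV_turning_points[OF assms(1) \<open>v < h2\<close>]
      dV_turning_points[OF \<open>h1 < v'\<close> assms(3)] turning \<open>uL v' < uL v\<close> \<open>uR v < uR v'\<close>
    by (intro convex_two_point_mean_mono[where f = "\<lambda>x. x ^ m"])
      (auto simp: turning_mean_def intro: power_mono)
  then show ?thesis
    by (simp add: turning_mean_def)
qed simp

lemma abel_density_single_crossing:
  assumes "h1 \<le> v" "v \<le> w" "w < h2" and "0 < abel_density n v - c * abel_density 0 v"
  shows "0 \<le> abel_density n w - c * abel_density 0 w"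
proof -
  have "v \<noteq> h1"
    using assms(4) abel_density_h1 by auto
  with assms have "h1 < v" "h1 < w" "v < h2"
    by auto
  have eq: "abel_density n x - c * abel_density 0 x = (turning_mean n x - c) * abel_density 0 x"
    if "h1 < x" "x < h2" for x
    using abel_density_eq_turning_mean[OF that, of n] by (simp add: algebra_simps)
  have "c < turning_mean n v"
    using assms(4) eq[of v] abel_density_0_pos[of v] \<open>h1 < v\<close> \<open>v < h2\<close>
    by (simp add: zero_less_mult_iff)
  also have "\<dots> \<le> turning_mean n w"
    using turning_mean_mono[of v w n] \<open>h1 < v\<close> assms by simp
  finally show ?thesis
    using eq[of w] abel_density_0_pos[of w] \<open>h1 < w\<close> assms by simp
qed

lemma G_mono:
  assumes "h1 < h" "h \<le> h'" "h' < h2"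
  shows "G \<beta> k u0 n h \<le> G \<beta> k u0 n h'"
proof (rule dense_le)
  fix c
  assume "c < G \<beta> k u0 n h"
  have h: "h1 < h" "h < h2" and h': "h1 < h'" "h' < h2"
    using assms by auto
  define P where "P v = abel_density n v - c * abel_density 0 v" for v
  have P_integral: "((\<lambda>v. P v * sqrt (2 * (x - v))) has_integral
      (oval_integral \<beta> k u0 n x - c * oval_integral \<beta> k u0 0 x) / 2) {h1..x}"
    if "h1 < x" "x < h2" for x
    using has_integral_diff[OF oval_integral_abel[OF that, of n]
        has_integral_mult_right[OF oval_integral_abel[OF that, of 0], of c]]
    by (simp add: P_def algebra_simps diff_divide_distrib)
  have "0 < (oval_integral \<beta> k u0 n h - c * oval_integral \<beta> k u0 0 h) / 2"
    using \<open>c < G \<beta> k u0 n h\<close> oval_integral_0_pos[OF h] by (simp add: G_def pos_less_divide_eq)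
  moreover have "0 \<le> P w" if "h1 \<le> v" "v \<le> w" "w \<le> h'" "0 < P v" for v w
    using abel_density_single_crossing[of v w] that h' by (simp add: P_def)
  ultimately have "0 \<le> integral {h1..h'} (\<lambda>v. P v * sqrt (2 * (h' - v)))"
    using single_crossing_kernel_integral_nonneg[OF \<open>h \<le> h'\<close> P_integral[OF h]]
      has_integral_integrable[OF P_integral[OF h']] by blast
  then show "c \<le> G \<beta> k u0 n h'"
    using integral_unique[OF P_integral[OF h']] oval_integral_0_pos[OF h']
    by (simp add: G_def pos_le_divide_eq)
qed

end

theorem proposition3p4:
  fixes n :: nat and \<beta> k u0 :: real
  assumes "n \<ge> 2" and "\<beta> > 0" and "0 < u0" and "u0 < k" and "k \<le> 2 * u0"
  shows "mono_on {\<beta> * u0 ^ 3 / 12 * (u0 - 2 * k) <..< \<beta> * k ^ 3 / 12 * (k - 2 * u0)}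
             (G \<beta> k u0 n)
       \<or> antimono_on {\<beta> * u0 ^ 3 / 12 * (u0 - 2 * k) <..< \<beta> * k ^ 3 / 12 * (k - 2 * u0)}
             (G \<beta> k u0 n)"
proof -
  interpret quartic_center \<beta> k u0
    using assms by unfold_locales auto
  have "mono_on {h1<..<h2} (G \<beta> k u0 n)"
    by (intro mono_onI) (use G_mono in auto)
  then show ?thesis
    unfolding h1_eq h2_eq by simp
qed

end
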